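(* For $(p,q)\in\mathbf{N}$ and every integer $k\ge1$, the $k$-th moment of $\Lambda^*_{p,q}$ is given by $$\mu_k(\Lambda_{p,q}^* )=\sum_{j\in\mathbb{Z}}\ \sum_{k_1+k_2+k_3=k}\ \sum_{k_1'+k_2'+k_3'=k}\binom{k}{k_1,k_2,k_3}\binom{k}{k_1',k_2',k_3'}\,\mathbf{1}\left\{k_1'=k_1+jp,\ k_2'=k_2+jq,\ k_3'=k_3-j(p+q)\right\},$$ where $k_1,k_2,k_3,k_1',k_2',k_3'$ range over non-negative integers.
   Context: $\mathbb{N}_0=\{0,1,2,\ldots\}$ and $\mathbf{N}:=\{(p,q)\in\mathbb{N}_0^2 : p+q\ge 5,\ q\le p\}$. For such $(p,q)$, $\Lambda^*_{p,q}$ denotes the random eigenvalue of the dual infinite $(p,q)$-nanotube (the triangular lattice with a loop of weight $3$ at each vertex, rolled up along the chiral vector $(p,q)$), i.e. the real random variable with compactly supported distribution whose moments $\mu_k(\Lambda^*_{p,q})=\mathbb{E}(\Lambda^*_{p,q})^k$, $k\in\mathbb{N}_0$, are the (weighted) numbers of closed paths with $k$ steps from a vertex of this graph, given by $$\mu_k(\Lambda^*_{p,q})=\frac{1}{(2\pi)^3}\sum_{j\in\mathbb{Z}}\int_{-\pi}^{\pi}\int_{-\pi}^{\pi}\int_{-\pi}^{\pi}\left|e^{ix}+e^{iy}+e^{iz}\right|^{2k}e^{ij(p(x-z)+q(y-z))}\,dx\,dy\,dz .$$ For each fixed $k$ only finitely many terms of the sum are non-zero. Here $\binom{k}{k_1,k_2,k_3}=\frac{k!}{k_1!k_2!k_3!}$,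 and $\mathbf{1}\{\cdot\}$ is $1$ if all listed conditions hold and $0$ otherwise. *)

theory Defs
  imports "HOL-Probability.Probability"
begin

section \<open>Dual infinite nanotubes\<close>

text \<open>
  A pair \<open>(a, b)\<close> stands for the point \<open>a e\<^sub>1 + b e\<^sub>2\<close> of the triangular lattice, where \<open>e\<^sub>1\<close> and
  \<open>e\<^sub>2\<close> are unit vectors at an angle of 60 degrees; the neighbours of the origin are therefore
  \<open>\<plusminus>e\<^sub>1\<close>, \<open>\<plusminus>e\<^sub>2\<close> and \<open>\<plusminus>(e\<^sub>1 - e\<^sub>2)\<close>. Rolling up along the chiral vector \<open>(p, q)\<close> identifies points
  that differ by an integer multiple of \<open>(p, q)\<close>, so a vertex of the nanotube is a coset.
\<close>

definition chiral_vectors :: "(nat \<times> nat) set" where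
  "chiral_vectors = {(p, q). p + q \<ge> 5 \<and> q \<le> p}"

definition triangular_steps :: "(int \<times> int) set" where
  "triangular_steps = {(1, 0), (-1, 0), (0, 1), (0, -1), (1, -1), (-1, 1)}"

definition nanotube_vertex :: "nat \<Rightarrow> nat \<Rightarrow> int \<times> int \<Rightarrow> (int \<times> int) set" where
  "nanotube_vertex p q u = {u + (j * int p, j * int q) | j. True}"

definition nanotube_vertices :: "nat \<Rightarrow> nat \<Rightarrow> (int \<times> int) set set" where
  "nanotube_vertices p q = range (nanotube_vertex p q)"

definition nanotube_weight :: "(int \<times> int) set \<Rightarrow> (int \<times> int) set \<Rightarrow> nat" where
  "nanotube_weight U V =
     (if U = V then 3 else if \<exists>u\<in>U. \<exists>v\<in>V. v - u \<in> triangular_steps then 1 else 0)"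

text \<open>
  The weighted number of paths with \<open>k\<close> steps, that is, an entry of the \<open>k\<close>-th power of the weighted
  adjacency matrix. The index set of the sum is finite because every vertex has degree at most 6
  apart from its loop.
\<close>

primrec nanotube_paths ::
  "nat \<Rightarrow> nat \<Rightarrow> nat \<Rightarrow> (int \<times> int) set \<Rightarrow> (int \<times> int) set \<Rightarrow> nat" where
  "nanotube_paths p q 0 U V = of_bool (U = V)"
| "nanotube_paths p q (Suc k) U V =
     (\<Sum>W\<in>{W \<in> nanotube_vertices p q. nanotube_weight U W \<noteq> 0}.
        nanotube_weight U W * nanotube_paths p q k W V)"

text \<open>
  The random eigenvalue is only determined in distribution. The choice of the base vertex is
  immaterial by the theorem \<open>nanotube_closed_paths_integral\<close> below.
\<close>

definition random_eigenvalue :: "nat \<Rightarrow> nat \<Rightarrow> 'a measure \<Rightarrow> ('a \<Rightarrow> real) \<Rightarrow> bool" where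
  "random_eigenvalue p q M \<Lambda> \<longleftrightarrow>
     prob_space M \<and>
     \<Lambda> \<in> borel_measurable M \<and>
     (\<exists>K. compact K \<and> (AE \<omega> in M. \<Lambda> \<omega> \<in> K)) \<and>
     (\<forall>k. prob_space.expectation M (\<lambda>\<omega>. \<Lambda> \<omega> ^ k) =
          real (nanotube_paths p q k (nanotube_vertex p q (0, 0)) (nanotube_vertex p q (0, 0))))"

definition trinomial :: "nat \<Rightarrow> nat \<Rightarrow> nat \<Rightarrow> nat \<Rightarrow> real" where
  "trinomial k k1 k2 k3 = fact k / (fact k1 * fact k2 * fact k3)"


section \<open>The integral formula for the number of closed paths\<close>

definition path_integrand :: "nat \<Rightarrow> int \<times> int \<Rightarrow> real \<times> real \<times> real \<Rightarrow> complex" where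
  "path_integrand k v = (\<lambda>(x, y, z).
     of_real (cmod (exp (\<i> * of_real x) + exp (\<i> * of_real y) + exp (\<i> * of_real z)) ^ (2 * k)) *
     exp (\<i> * of_real (of_int (fst v) * (x - z) + of_int (snd v) * (y - z))))"

definition path_integral :: "nat \<Rightarrow> int \<times> int \<Rightarrow> complex" where
  "path_integral k v = 1 / (2 * of_real pi) ^ 3 *
     integral {-pi..pi} (\<lambda>x. integral {-pi..pi} (\<lambda>y. integral {-pi..pi} (\<lambda>z.
       path_integrand k v (x, y, z))))"

lemma continuous_path_integrand: "continuous_on A (path_integrand k v)"
  unfolding path_integrand_def case_prod_unfold by (intro continuous_intros)

lemma path_integral_cbox:
  "path_integral k v = 1 / (2 * of_real pi) ^ 3 *
     integral (cbox (-pi, -pi, -pi) (pi, pi, pi)) (path_integrand k v)"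
proof -
  have cont: "continuous_on (cbox (-pi, -pi) (pi, pi)) (\<lambda>w. path_integrand k v (x, w))" for x
    by (intro continuous_on_compose2[OF continuous_path_integrand[of UNIV]] continuous_intros) auto
  have "integral (cbox (-pi, -pi, -pi) (pi, pi, pi)) (path_integrand k v) =
     integral (cbox (-pi) pi) (\<lambda>x. integral (cbox (-pi, -pi) (pi, pi))
       (\<lambda>w. path_integrand k v (x, w)))"
    by (rule integral_prod_continuous) (rule continuous_path_integrand)
  also have "\<dots> = integral (cbox (-pi) pi) (\<lambda>x. integral (cbox (-pi) pi) (\<lambda>y.
       integral (cbox (-pi) pi) (\<lambda>z. path_integrand k v (x, y, z))))"
    by (intro integral_cong integral_prod_continuous[OF cont])
  finally show ?thesis
    by (simp add: path_integral_def)
qed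

lemma integral_exp_int:
  "integral {-pi..pi} (\<lambda>x. exp (\<i> * of_real (of_int n * x))) = 2 * of_real pi * of_bool (n = 0)"
proof (cases "n = 0")
  case False
  define F where "F x = exp (\<i> * of_int n * of_real x) / (\<i> * of_int n)" for x :: real
  have "(F has_vector_derivative exp (\<i> * of_real (of_int n * x))) (at x within {-pi..pi})" for x
  proof -
    have "((\<lambda>w. exp (\<i> * of_int n * w) / (\<i> * of_int n)) has_field_derivative
        exp (\<i> * of_int n * of_real x)) (at (of_real x))"
      using False by (auto intro!: derivative_eq_intros)
    from has_vector_derivative_real_field[OF this] show ?thesis
      unfolding F_def by (simp add: o_def mult.assoc)
  qed
  then have "((\<lambda>x. exp (\<i> * of_real (of_int n * x))) has_integral (F pi - F (-pi))) {-pi..pi}"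
    by (intro fundamental_theorem_of_calculus) auto
  moreover have "F pi = F (-pi)"
  proof -
    have "exp (\<i> * of_int n * of_real pi) = exp (\<i> * of_int n * of_real (-pi))"
      unfolding exp_eq by (intro exI[of _ n]) (simp add: algebra_simps)
    then show ?thesis by (simp add: F_def)
  qed
  ultimately show ?thesis
    using False by (simp add: integral_unique)
qed (simp add: scaleR_conv_of_real)

lemma path_integral_0: "path_integral 0 v = of_bool (v = (0, 0))"
proof -
  obtain a b where v: "v = (a, b)" by force
  have *: "path_integrand 0 v (x, y, z) =
      exp (\<i> * of_real (of_int a * x)) * (exp (\<i> * of_real (of_int b * y)) *
      exp (\<i> * of_real (of_int (- a - b) * z)))" for x y z
    by (simp add: path_integrand_def v algebra_simps flip: exp_add)
  show ?thesis
    unfolding path_integral_def * 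
    unfolding integral_mult_right integral_mult_left integral_exp_int
    by (auto simp: v power3_eq_cube)
qed

lemma path_integrand_Suc:
  "path_integrand (Suc k) v w =
     3 * path_integrand k v w + (\<Sum>n\<in>triangular_steps. path_integrand k (v + n) w)"
proof -
  obtain a b x y z where v: "v = (a, b)" and w: "w = (x, y, z)" by (metis surj_pair)
  define E where "E t = exp (\<i> * of_real t)" for t :: real
  have E_add: "E s * E t = E (s + t)" for s t
    by (simp add: E_def distrib_left flip: exp_add)
  have cnj_E: "cnj (E t) = E (- t)" for t
    by (simp add: E_def exp_cnj)
  have "complex_of_real (cmod (E x + E y + E z) ^ 2) = (E x + E y + E z) * cnj (E x + E y + E z)"
    by (metis complex_norm_square of_real_power)
  also have "\<dots> = 3 + E (x - z) + E (z - x) + E (y - z) + E (z - y) + E (x - y) + E (y - x)"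
    by (simp add: cnj_E algebra_simps E_add) (simp add: E_def)
  finally have 1: "complex_of_real (cmod (E x + E y + E z) ^ 2) = \<dots>" .
  define c where "c = complex_of_real (cmod (E x + E y + E z) ^ (2 * k))"
  define P where "P a b = E (a * (x - z) + b * (y - z))" for a b :: real
  have I: "path_integrand k (i, j) w = c * P (of_int i) (of_int j)" for i j
    by (simp add: path_integrand_def w c_def P_def E_def)
  have "path_integrand (Suc k) v w =
      c * complex_of_real (cmod (E x + E y + E z) ^ 2) * P (of_int a) (of_int b)"
    by (simp add: path_integrand_def v w c_def P_def E_def power_add power2_eq_square mult_ac)
  also have "\<dots> = c * (3 * P a b + P (a + 1) b + P (a - 1) b + P a (b + 1) + P a (b - 1) +
      P (a + 1) (b - 1) + P (a - 1) (b + 1))"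
    unfolding 1 P_def by (simp add: algebra_simps E_add)
  also have "\<dots> = 3 * path_integrand k v w +
      (\<Sum>n\<in>triangular_steps. path_integrand k (v + n) w)"
    by (simp add: triangular_steps_def v I algebra_simps)
  finally show ?thesis .
qed

lemma path_integral_Suc:
  "path_integral (Suc k) v =
     3 * path_integral k v + (\<Sum>n\<in>triangular_steps. path_integral k (v + n))"
proof -
  let ?B = "cbox (-pi, -pi, -pi) (pi, pi, pi)"
  have int: "path_integrand k u integrable_on ?B" for u
    by (intro integrable_continuous continuous_path_integrand)
  have fin: "finite triangular_steps"
    by (simp add: triangular_steps_def)
  have "integral ?B (path_integrand (Suc k) v) =
      3 * integral ?B (path_integrand k v) +
      (\<Sum>n\<in>triangular_steps. integral ?B (path_integrand k (v + n)))"
    unfolding path_integrand_Suc[abs_def]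
    by (subst integral_add)
       (auto simp: integral_sum[OF fin int] intro!: integrable_sum fin int integrable_on_mult_right)
  then show ?thesis
    by (simp add: path_integral_cbox distrib_left sum_distrib_left)
qed

lemma nanotube_vertex_eq_iff:
  "nanotube_vertex p q u = nanotube_vertex p q v \<longleftrightarrow> (\<exists>j. u = v + (j * int p, j * int q))"
    (is "?L \<longleftrightarrow> ?R")
proof
  assume ?L
  moreover have "u \<in> nanotube_vertex p q u"
    by (auto simp: nanotube_vertex_def intro!: exI[of _ 0] prod_eqI)
  ultimately show ?R by (auto simp: nanotube_vertex_def)
next
  assume ?R
  then obtain j where j: "u = v + (j * int p, j * int q)" by blast
  have "u + (i * int p, i * int q) = v + ((i + j) * int p, (i + j) * int q)"
       "v + (i * int p, i * int q) = u + ((i - j) * int p, (i - j) * int q)" for i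
    by (auto simp: j algebra_simps intro!: prod_eqI)
  then show ?L unfolding nanotube_vertex_def by blast
qed

lemma nanotube_vertex_inj_steps:
  assumes "(p, q) \<in> chiral_vectors"
  shows "inj_on (\<lambda>n. nanotube_vertex p q (u + n)) (insert (0, 0) triangular_steps)"
proof (rule inj_onI)
  fix m n assume mn: "m \<in> insert (0, 0) triangular_steps" "n \<in> insert (0, 0) triangular_steps"
    and "nanotube_vertex p q (u + m) = nanotube_vertex p q (u + n)"
  then obtain j where j: "m = n + (j * int p, j * int q)"
    by (auto simp: nanotube_vertex_eq_iff add.assoc)
  have "int p \<ge> 3" using assms by (auto simp: chiral_vectors_def)
  have "\<bar>j * int p\<bar> \<le> 2"
    using mn j by (cases m; cases n) (auto simp: triangular_steps_def)
  then have "j = 0"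
  proof -
    have "\<bar>j\<bar> * 3 \<le> \<bar>j\<bar> * int p" using \<open>int p \<ge> 3\<close> by (intro mult_left_mono) auto
    also have "\<dots> = \<bar>j * int p\<bar>" by (simp add: abs_mult)
    finally show ?thesis using \<open>\<bar>j * int p\<bar> \<le> 2\<close> by linarith
  qed
  with j show "m = n" by (cases n) auto
qed

lemma nanotube_adjacent_iff:
  "(\<exists>u'\<in>nanotube_vertex p q u. \<exists>w\<in>nanotube_vertex p q v. w - u' \<in> triangular_steps) \<longleftrightarrow>
   (\<exists>n\<in>triangular_steps. nanotube_vertex p q v = nanotube_vertex p q (u + n))"
proof safe
  fix u' w assume "u' \<in> nanotube_vertex p q u" "w \<in> nanotube_vertex p q v"
    and s: "w - u' \<in> triangular_steps"
  then obtain i j where "u' = u + (i * int p, i * int q)" "w = v + (j * int p, j * int q)"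
    by (auto simp: nanotube_vertex_def)
  then have "v = u + (w - u') + ((i - j) * int p, (i - j) * int q)"
    by (intro prod_eqI) (auto simp: algebra_simps)
  then show "\<exists>n\<in>triangular_steps. nanotube_vertex p q v = nanotube_vertex p q (u + n)"
    using s unfolding nanotube_vertex_eq_iff by blast
next
  fix n assume "n \<in> triangular_steps" "nanotube_vertex p q v = nanotube_vertex p q (u + n)"
  moreover have "w \<in> nanotube_vertex p q w" for w
    by (auto simp: nanotube_vertex_def intro!: exI[of _ 0] prod_eqI)
  ultimately show "\<exists>u'\<in>nanotube_vertex p q u. \<exists>w\<in>nanotube_vertex p q v. w - u' \<in> triangular_steps"
    by (metis add_diff_cancel_left')
qed

lemma nanotube_paths_Suc:
  assumes "(p, q) \<in> chiral_vectors"
  shows "nanotube_paths p q (Suc k) (nanotube_vertex p q u) V =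
    3 * nanotube_paths p q k (nanotube_vertex p q u) V +
    (\<Sum>n\<in>triangular_steps. nanotube_paths p q k (nanotube_vertex p q (u + n)) V)"
proof -
  let ?f = "\<lambda>n. nanotube_vertex p q (u + n)"
  let ?S = "insert (0, 0) triangular_steps"
  note inj = nanotube_vertex_inj_steps[OF assms, of u]
  have z: "u + (0, 0) = u" by (simp flip: zero_prod_def)
  have notin: "(0, 0) \<notin> triangular_steps" and fin: "finite triangular_steps"
    by (auto simp: triangular_steps_def)
  have set: "{W \<in> nanotube_vertices p q. nanotube_weight (nanotube_vertex p q u) W \<noteq> 0} = ?f ` ?S"
  proof -
    have "nanotube_weight (nanotube_vertex p q u) (nanotube_vertex p q w) \<noteq> 0 \<longleftrightarrow>
        nanotube_vertex p q w \<in> ?f ` ?S" for w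
      unfolding nanotube_weight_def nanotube_adjacent_iff 
      by (cases "nanotube_vertex p q w = nanotube_vertex p q u") (simp_all add: image_iff z)
    then show ?thesis
      unfolding nanotube_vertices_def by blast
  qed
  have w0: "nanotube_weight (nanotube_vertex p q u) (?f (0, 0)) = 3"
    by (simp add: nanotube_weight_def z)
  have w1: "nanotube_weight (nanotube_vertex p q u) (?f n) = 1" if "n \<in> triangular_steps" for n
  proof -
    have "?f n \<noteq> ?f (0, 0)"
      using inj_onD[OF inj, of n "(0, 0)"] that notin by auto
    then show ?thesis
      using that by (auto simp: nanotube_weight_def nanotube_adjacent_iff z)
  qed
  show ?thesis
    unfolding nanotube_paths.simps set sum.reindex[OF inj] o_def
    using fin notin by (simp add: w0[unfolded z] w1 z)
qed

lemma has_sum_finite_sum: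
  fixes f :: "'b \<Rightarrow> 'c \<Rightarrow> 'a::topological_comm_monoid_add"
  assumes "finite A" "\<And>i. i \<in> A \<Longrightarrow> (f i has_sum s i) B"
  shows "((\<lambda>x. \<Sum>i\<in>A. f i x) has_sum (\<Sum>i\<in>A. s i)) B"
  using assms by (induction A) (auto intro: has_sum_add)

lemma nanotube_paths_has_sum:
  assumes "(p, q) \<in> chiral_vectors"
  shows "((\<lambda>j. path_integral k (u - v + (j * int p, j * int q))) has_sum
    of_nat (nanotube_paths p q k (nanotube_vertex p q u) (nanotube_vertex p q v))) UNIV"
proof (induction k arbitrary: u)
  case 0
  define J where "J = {j. u - v + (j * int p, j * int q) = (0, 0)}"
  have p: "int p > 0" using assms by (auto simp: chiral_vectors_def)
  have J: "J = {} \<or> (\<exists>j. J = {j})"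
  proof (cases "J = {}")
    case False
    then obtain j where "j \<in> J" by blast
    moreover have "i = j" if "i \<in> J" "j \<in> J" for i j
    proof -
      have "i * int p = j * int p"
        using that unfolding J_def mem_Collect_eq prod_eq_iff fst_add fst_conv by linarith
      then show ?thesis using p by simp
    qed
    ultimately show ?thesis by blast
  qed simp
  have J': "nanotube_vertex p q u = nanotube_vertex p q v \<longleftrightarrow> J \<noteq> {}"
  proof -
    have "u = v + (j * int p, j * int q) \<longleftrightarrow> - j \<in> J" for j
      by (cases u; cases v) (auto simp: J_def algebra_simps)
    then show ?thesis
      unfolding nanotube_vertex_eq_iff by (metis all_not_in_conv minus_minus)
  qed
  show ?case
    unfolding nanotube_paths.simps path_integral_0 J'
    by (rule has_sum_finite_neutralI[of J]) (use J in \<open>auto simp: J_def\<close>)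
next
  case (Suc k)
  have [simp]: "u + n - v + w = u - v + w + n" for n w :: "int \<times> int"
    by simp
  have "((\<lambda>j. 3 * path_integral k (u - v + (j * int p, j * int q)) +
      (\<Sum>n\<in>triangular_steps. path_integral k (u + n - v + (j * int p, j * int q)))) has_sum
      3 * of_nat (nanotube_paths p q k (nanotube_vertex p q u) (nanotube_vertex p q v)) +
      (\<Sum>n\<in>triangular_steps. of_nat
        (nanotube_paths p q k (nanotube_vertex p q (u + n)) (nanotube_vertex p q v)))) UNIV"
    by (intro has_sum_add has_sum_cmult_right has_sum_finite_sum Suc)
       (simp add: triangular_steps_def)
  then show ?case
    unfolding nanotube_paths_Suc[OF assms] path_integral_Suc by simp
qed

theorem nanotube_closed_paths_integral:
  assumes "(p, q) \<in> chiral_vectors" and "U \<in> nanotube_vertices p q"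
  shows "((\<lambda>j. 1 / (2 * of_real pi) ^ 3 *
      integral {-pi..pi} (\<lambda>x. integral {-pi..pi} (\<lambda>y. integral {-pi..pi} (\<lambda>z.
        of_real (cmod (exp (\<i> * of_real x) + exp (\<i> * of_real y) + exp (\<i> * of_real z)) ^ (2 * k)) *
        exp (\<i> * of_int j * (of_nat p * of_real (x - z) + of_nat q * of_real (y - z))))))) has_sum
      complex_of_real (real (nanotube_paths p q k U U))) UNIV"
proof -
  obtain u where U: "U = nanotube_vertex p q u"
    using assms(2) by (auto simp: nanotube_vertices_def)
  have "path_integrand k (u - u + (j * int p, j * int q)) (x, y, z) =
      of_real (cmod (exp (\<i> * of_real x) + exp (\<i> * of_real y) + exp (\<i> * of_real z)) ^ (2 * k)) *
      exp (\<i> * of_int j * (of_nat p * of_real (x - z) + of_nat q * of_real (y - z)))" for j x y z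
    by (simp add: path_integrand_def algebra_simps)
  then show ?thesis
    using nanotube_paths_has_sum[OF assms(1), of k u u]
    unfolding U path_integral_def by simp
qed

end

theory Submission
  imports Defs
begin

text \<open>
  Expanding \<open>(e\<^sup>i\<^sup>x + e\<^sup>i\<^sup>y + e\<^sup>i\<^sup>z)\<^sup>k\<close> and its conjugate by the trinomial theorem turns the integrand of
  the moment formula into a trigonometric polynomial. Integration over the cube keeps only the
  constant terms, and their condition on the exponents is the one in the indicator.
\<close>

abbreviation compositions3 :: "nat \<Rightarrow> (nat \<times> nat \<times> nat) set" where
  "compositions3 k \<equiv> {(k1, k2, k3). k1 + k2 + k3 = k}"

lemma finite_compositions3: "finite (compositions3 k)"
  by (rule finite_subset[of _ "{..k} \<times> {..k} \<times> {..k}"]) auto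

text \<open>Apply the binomial theorem to \<open>a + (b + c)\<close> and again to
  \<open>b + c\<close>. The trinomial coefficient is the product of the two binomial coefficients
  that arise.\<close>

lemma trinomial_theorem:
  fixes a b c :: "'a::{real_algebra_1, comm_ring_1}"
  shows "(a + b + c) ^ k =
    (\<Sum>(k1, k2, k3)\<in>compositions3 k. of_real (trinomial k k1 k2 k3) * (a ^ k1 * b ^ k2 * c ^ k3))"
proof -
  have coeff: "trinomial k i l (k - i - l) = real (k choose i) * real ((k - i) choose l)"
    if "i \<le> k" "l \<le> k - i" for i l
    using that by (simp add: trinomial_def binomial_fact)
  have "(a + b + c) ^ k = (\<Sum>i\<le>k. of_nat (k choose i) * a ^ i * (b + c) ^ (k - i))"
    by (subst binomial_ring[symmetric]) (simp add: add.assoc)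
  also have "\<dots> = (\<Sum>i\<le>k. \<Sum>l\<le>k - i.
      of_real (trinomial k i l (k - i - l)) * (a ^ i * b ^ l * c ^ (k - i - l)))"
    by (auto intro!: sum.cong simp: binomial_ring sum_distrib_left coeff mult_ac simp del: diff_diff_left)
  also have "\<dots> = (\<Sum>(i, l)\<in>Sigma {..k} (\<lambda>i. {..k - i}).
      of_real (trinomial k i l (k - i - l)) * (a ^ i * b ^ l * c ^ (k - i - l)))"
    by (rule sum.Sigma) auto
  also have "\<dots> = (\<Sum>(k1, k2, k3)\<in>compositions3 k.
      of_real (trinomial k k1 k2 k3) * (a ^ k1 * b ^ k2 * c ^ k3))"
    \<comment> \<open>A composition of \<open>k\<close> into three parts is determined by its first
      two parts.\<close>
    by (rule sum.reindex_bij_witness[of _ "\<lambda>(k1, k2, k3). (k1, k2)" "\<lambda>(i, l). (i, l, k - i - l)"])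
       auto
  finally show ?thesis .
qed

text \<open>These are the characters of the three-dimensional torus. With the product nested to the
  right, integration over \<open>z\<close>, then \<open>y\<close>, then \<open>x\<close> can pull
  the remaining factors out one at a time.\<close>

definition cis_monomial :: "int \<Rightarrow> int \<Rightarrow> int \<Rightarrow> real \<times> real \<times> real \<Rightarrow> complex" where
  "cis_monomial a b c = (\<lambda>(x, y, z). cis (of_int a * x) * (cis (of_int b * y) * cis (of_int c * z)))"

lemma continuous_cis_monomial: "continuous_on A (cis_monomial a b c)"
  unfolding cis_monomial_def case_prod_unfold by (intro continuous_intros)

text \<open>Orthogonality of characters: by Fubini the integral is a product of three
  one-dimensional ones, each vanishing unless its frequency is zero.\<close>

lemma integral_cis_monomial:
  "integral (cbox (-pi, -pi, -pi) (pi, pi, pi)) (cis_monomial a b c) =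
     (2 * of_real pi) ^ 3 * of_bool (a = 0 \<and> b = 0 \<and> c = 0)"
proof -
  have int: "integral {-pi..pi} (\<lambda>x. cis (of_int n * x)) = 2 * of_real pi * of_bool (n = 0)" for n
    using integral_exp_int[of n] by (simp add: cis_conv_exp)
  have cont: "continuous_on (cbox (-pi, -pi) (pi, pi)) (\<lambda>w. cis_monomial a b c (x, w))" for x
    by (intro continuous_on_compose2[OF continuous_cis_monomial[of UNIV]] continuous_intros) auto
  have "integral (cbox (-pi, -pi, -pi) (pi, pi, pi)) (cis_monomial a b c) =
     integral (cbox (-pi) pi) (\<lambda>x. integral (cbox (-pi, -pi) (pi, pi))
       (\<lambda>w. cis_monomial a b c (x, w)))"
    by (rule integral_prod_continuous) (rule continuous_cis_monomial)
  also have "\<dots> = integral (cbox (-pi) pi) (\<lambda>x. integral (cbox (-pi) pi) (\<lambda>y.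
       integral (cbox (-pi) pi) (\<lambda>z. cis_monomial a b c (x, y, z))))"
    by (intro integral_cong integral_prod_continuous[OF cont])
  also have "\<dots> = (2 * of_real pi) ^ 3 * of_bool (a = 0 \<and> b = 0 \<and> c = 0)"
    unfolding cis_monomial_def prod.case cbox_interval
      integral_mult_right integral_mult_left int
    by (simp add: power3_eq_cube)
  finally show ?thesis .
qed

text \<open>The primed exponents come from the conjugate factor and hence enter with a minus sign.
  The phase \<open>a * (x - z) + b * (y - z)\<close> adds \<open>a\<close>, \<open>b\<close> and
  \<open>- a - b\<close> to the three frequencies.\<close>

lemma path_integrand_expansion:
  "path_integrand k (a, b) w =
    (\<Sum>(k1, k2, k3)\<in>compositions3 k. \<Sum>(k1', k2', k3')\<in>compositions3 k.
      of_real (trinomial k k1 k2 k3 * trinomial k k1' k2' k3') *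
      cis_monomial (int k1 - int k1' + a) (int k2 - int k2' + b) (int k3 - int k3' - a - b) w)"
proof -
  obtain x y z where w: "w = (x, y, z)" by (metis surj_pair)
  have monomial: "of_real s * (cis x ^ k1 * cis y ^ k2 * cis z ^ k3) *
      (of_real t * (cnj (cis x) ^ k1' * cnj (cis y) ^ k2' * cnj (cis z) ^ k3') *
        cis (of_int a * (x - z) + of_int b * (y - z))) =
      of_real (s * t) *
      cis_monomial (int k1 - int k1' + a) (int k2 - int k2' + b) (int k3 - int k3' - a - b) w"
    for s t k1 k2 k3 k1' k2' k3'
    by (simp add: w cis_monomial_def cis_cnj Complex.DeMoivre cis_mult algebra_simps)
  define S where "S = cis x + cis y + cis z"
  have "complex_of_real (cmod S ^ (2 * k)) = (S * cnj S) ^ k"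
    by (metis complex_norm_square of_real_power power_mult)
  then have "path_integrand k (a, b) w =
      S ^ k * (cnj S ^ k * cis (of_int a * (x - z) + of_int b * (y - z)))"
    by (simp add: path_integrand_def w S_def cis_conv_exp power_mult_distrib)
  also have "\<dots> = (\<Sum>(k1, k2, k3)\<in>compositions3 k. \<Sum>(k1', k2', k3')\<in>compositions3 k.
      of_real (trinomial k k1 k2 k3 * trinomial k k1' k2' k3') *
      cis_monomial (int k1 - int k1' + a) (int k2 - int k2' + b) (int k3 - int k3' - a - b) w)"
    \<comment> \<open>Only the phase is moved into the sum for the conjugate power, so that a
      product of exactly two sums remains to be expanded.\<close>
    unfolding S_def complex_cnj_add trinomial_theorem sum_distrib_right[of _ _ "cis _"]
      sum_product case_prod_unfold monomial ..
  finally show ?thesis .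
qed

text \<open>Only terms whose three frequencies all vanish survive, and the factor
  \<open>(2 * pi) ^ 3\<close> cancels the normalisation. The value is thus real, which later allows
  the passage from complex to real sums.\<close>

lemma path_integral_trinomial:
  "path_integral k (a, b) =
    of_real (\<Sum>(k1, k2, k3)\<in>compositions3 k. \<Sum>(k1', k2', k3')\<in>compositions3 k.
      trinomial k k1 k2 k3 * trinomial k k1' k2' k3' *
      of_bool (int k1' = int k1 + a \<and> int k2' = int k2 + b \<and> int k3' = int k3 - (a + b)))"
proof -
  let ?B = "cbox (-pi, -pi, -pi) (pi, pi, pi)"
  have int: "cis_monomial r s t integrable_on ?B" for r s t
    by (intro integrable_continuous continuous_cis_monomial)
  have cond: "int k1 - int k1' + a = 0 \<and> int k2 - int k2' + b = 0 \<and> int k3 - int k3' - a = b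
      \<longleftrightarrow> int k1' = int k1 + a \<and> int k2' = int k2 + b \<and> int k3' = int k3 - (a + b)"
    for k1 k2 k3 k1' k2' k3'
    by linarith
  have "integral ?B (path_integrand k (a, b)) =
    (\<Sum>(k1, k2, k3)\<in>compositions3 k. \<Sum>(k1', k2', k3')\<in>compositions3 k.
      of_real (trinomial k k1 k2 k3 * trinomial k k1' k2' k3') *
      ((2 * of_real pi) ^ 3 *
       of_bool (int k1' = int k1 + a \<and> int k2' = int k2 + b \<and> int k3' = int k3 - (a + b))))"
    unfolding path_integrand_expansion[abs_def] case_prod_unfold
    by (simp add: integral_sum finite_compositions3[unfolded case_prod_unfold] integrable_sum integrable_on_mult_right int
        integral_cis_monomial cond del: of_real_mult)
  moreover have "complex_of_real (of_bool P) = of_bool P" for P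
    by simp
  ultimately show ?thesis
    by (simp add: path_integral_cbox sum_distrib_left case_prod_unfold mult.assoc)
qed

theorem proposition2:
  fixes p q k :: nat and M :: "'a measure" and \<Lambda> :: "'a \<Rightarrow> real"
  assumes "(p, q) \<in> chiral_vectors"
    and "random_eigenvalue p q M \<Lambda>"
    and "k \<ge> 1"
  shows "prob_space.expectation M (\<lambda>\<omega>. \<Lambda> \<omega> ^ k) =
    (\<Sum>\<^sub>\<infinity>j\<in>(UNIV :: int set).
      \<Sum>(k1, k2, k3)\<in>{(k1, k2, k3). k1 + k2 + k3 = k}.
      \<Sum>(k1', k2', k3')\<in>{(k1', k2', k3'). k1' + k2' + k3' = k}.
        trinomial k k1 k2 k3 * trinomial k k1' k2' k3' *
        of_bool (int k1' = int k1 + j * int p \<and>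
                 int k2' = int k2 + j * int q \<and>
                 int k3' = int k3 - j * (int p + int q)))"
    (is "_ = infsum ?f UNIV")
proof -
  let ?N = "real (nanotube_paths p q k (nanotube_vertex p q (0, 0)) (nanotube_vertex p q (0, 0)))"
  \<comment> \<open>For closed paths the displacement is a multiple \<open>j\<close> of the chiral
    vector, so \<open>a = j * p\<close> and \<open>b = j * q\<close>.\<close>
  have "path_integral k ((0, 0) - (0, 0) + (j * int p, j * int q)) = of_real (?f j)" for j
    by (simp add: path_integral_trinomial distrib_left del: of_real_sum)
  then have "((\<lambda>j. complex_of_real (?f j)) has_sum of_real ?N) UNIV"
    using nanotube_paths_has_sum[OF assms(1), of k "(0, 0)" "(0, 0)"] by simp
  \<comment> \<open>This includes summability over \<open>j\<close>, so the \<open>infsum\<close>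
    below is a genuine sum and not the default value 0.\<close>
  then have "(?f has_sum ?N) UNIV"
    by (simp only: has_sum_of_real_iff)
  then have "infsum ?f UNIV = ?N"
    by (rule infsumI)
  then show ?thesis
    using assms(2) by (simp add: random_eigenvalue_def)
qed

end
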